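(* Let $\alpha\in(0,1)$. Suppose that: (1) $\{z_t\}_{t\ge1}$ is a stationary ergodic stochastic process, such that for every $k\ge1$, every function $g:\mathcal Z^k\to\mathbb R$ with $\mathbb E[|g(z_{1:k})|]<\infty$ and every $\varepsilon>0$, $$\lim_{n\to\infty}\mathbb P\Big(\Big|\tfrac1n\sum_{t=1}^n g(z_{t:t+k-1})-\mathbb E[g(z_{1:k})]\Big|\ge\varepsilon\Big)=0;$$ (2) the distribution $\mathcal L$ of $(\mathrm{Err}_\star^{\mathrm{val}},\mathrm{Err}_\star^{\mathrm{test}})$ has a density with respect to Lebesgue measure; (3) $\mathcal F$ is a finite class of functions $\mathbb R^m\to\mathbb R$, with $\mathcal F_{\alpha/2}\cap\mathcal F\ne\emptyset$ and $\mathcal F_{1-\alpha/2}\cap\mathcal F\neq\emptyset$. Let $\mathrm{PI}^{\alpha}_{\mathrm{QFCV}}$ be the output of the QFCV algorithm run on $z_{1:n}$. Then $$\lim_{n\to\infty}\mathbb P\big(\mathrm{Err}_{\mathrm{sto}}\in \mathrm{PI}^{\alpha}_{\mathrm{QFCV}}\big)=1-\alpha .$$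
   Context: Data: $z_t=(x_t,y_t)\in\mathcal Z=\mathcal X\times\mathcal Y$, $t\ge1$; $z_{a:b}=(z_a,\dots,z_b)$, and $z_D=(z_t)_{t\in D}$ for an index set $D$. Fixed positive integers: $n_{\mathrm{tr}},n_{\mathrm{val}},n_{\mathrm{te}}$ (training, validation, test sizes), shift $\Delta\ge 1$, feature dimension $m$. Fixed functions: a forecaster $\hat f:\mathcal X\times\mathcal Z^{n_{\mathrm{tr}}}\to\mathcal Y$, a loss $\ell:\mathcal Y\times\mathcal Y\to\mathbb R$, and an auxiliary function $\mathcal A:\mathcal Z^{n_{\mathrm{tr}}}\times\mathcal Z^{n_{\mathrm{val}}}\to\mathbb R^m$. Having observed $z_{1:n}$, the stochastic prediction error is $$\mathrm{Err}_{\mathrm{sto}}=\frac1{n_{\mathrm{te}}}\sum_{t=n+1}^{n+n_{\mathrm{te}}}\ell\big(\hat f(x_t;z_{n-n_{\mathrm{tr}}+1:n}),y_t\big).$$ Time windows: let $K=\lfloor (n-n_{\mathrm{tr}}-n_{\mathrm{val}}-n_{\mathrm{te}})/\Delta\rfloor+1$ and for $i\ge 1$ put $a_i=(i-1)\Delta$, $D_i=\{a_i+1,\dots,a_i+n_{\mathrm{tr}}\}$, $V_i=\{a_i+n_{\mathrm{tr}}+1,\dots,a_i+n_{\mathrm{tr}}+n_{\mathrm{val}}\}$, $D_{i\star}=\{a_i+n_{\mathrm{val}}+1,\dots,a_i+n_{\mathrm{tr}}+n_{\mathrm{val}}\}$, $T_i=\{a_i+n_{\mathrm{tr}}+n_{\mathrm{val}}+1,\dots,a_i+n_{\mathrm{tr}}+n_{\mathrm{val}}+n_{\mathrm{te}}\}$;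 and $D=\{n-n_{\mathrm{tr}}-n_{\mathrm{val}}+1,\dots,n-n_{\mathrm{val}}\}$, $V=\{n-n_{\mathrm{val}}+1,\dots,n\}$, $D_\star=\{n-n_{\mathrm{tr}}+1,\dots,n\}$, $T=\{n+1,\dots,n+n_{\mathrm{te}}\}$. Errors: $\mathrm{Err}_i^{\mathrm{val}}=\mathcal A(z_{D_i},z_{V_i})\in\mathbb R^m$, $\mathrm{Err}_i^{\mathrm{test}}=\frac1{|T_i|}\sum_{t\in T_i}\ell(\hat f(x_t;z_{D_{i\star}}),y_t)\in\mathbb R$, $\mathrm{Err}_\star^{\mathrm{val}}=\mathcal A(z_D,z_V)$, $\mathrm{Err}_\star^{\mathrm{test}}=\frac1{|T|}\sum_{t\in T}\ell(\hat f(x_t;z_{D_\star}),y_t)=\mathrm{Err}_{\mathrm{sto}}$. By stationarity of $\{z_t\}$, all pairs $(\mathrm{Err}_i^{\mathrm{val}},\mathrm{Err}_i^{\mathrm{test}})$ and $(\mathrm{Err}_\star^{\mathrm{val}},\mathrm{Err}_\star^{\mathrm{test}})$ have the same distribution, denoted $\mathcal L$. Pinball loss: $\mathrm{pinball}_\beta(t)=-t\,(1\{t\le0\}-\beta)$. QFCV algorithm: for $\beta\in\{\alpha/2,1-\alpha/2\}$ compute $\hat f^\beta\in\arg\min_{f\in\mathcal F}\frac1K\sum_{i=1}^K\mathrm{pinball}_\beta(\mathrm{Err}_i^{\mathrm{test}}-f(\mathrm{Err}_i^{\mathrm{val}}))$; output $\mathrm{PI}^\alpha_{\mathrm{QFCV}}=[\hat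 f^{\alpha/2}(\mathrm{Err}_\star^{\mathrm{val}}),\hat f^{1-\alpha/2}(\mathrm{Err}_\star^{\mathrm{val}})]$. $\mathcal F_\beta$ is the class of $\beta$-quantiles of the conditional distribution of $\mathrm{Err}_\star^{\mathrm{test}}$ given $\mathrm{Err}_\star^{\mathrm{val}}$, expressed as the set of minimizers $\arg\min_{g:\mathbb R^m\to\mathbb R}\mathbb E_{\mathcal L}[\mathrm{pinball}_\beta(\mathrm{Err}^{\mathrm{test}}-g(\mathrm{Err}^{\mathrm{val}}))]$, where $(\mathrm{Err}^{\mathrm{val}},\mathrm{Err}^{\mathrm{test}})\sim\mathcal L$.
   Formalization: The law of large numbers in (1) is also required for blocks starting at the window offsets (i-1)Δ (nothing new if Δ=1; for Δ≥2 the claim fails without it, e.g. for a random-phase periodic process), and minimizers defining F_β must have finite expected loss. *)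

theory Defs
  imports "HOL-Probability.Probability"
begin

text \<open>
  A process is \<open>z :: nat \<Rightarrow> 'w \<Rightarrow> 'z\<close>; only the times \<open>t \<ge> 1\<close> matter. The tuple
  \<open>z\<^bsub>a+1:a+k\<^esub>\<close>, for any offset \<open>a\<close>, is re-indexed by \<open>{1..k}\<close>, so that it is an element of
  \<open>\<Z>\<^sup>k\<close>, rendered as \<open>tuples k \<Z>\<close>.
\<close>

abbreviation tuples :: "nat \<Rightarrow> 'z measure \<Rightarrow> (nat \<Rightarrow> 'z) measure" where
  "tuples k MZ \<equiv> PiM {1..k} (\<lambda>_. MZ)"

definition block :: "(nat \<Rightarrow> 'w \<Rightarrow> 'z) \<Rightarrow> nat \<Rightarrow> nat \<Rightarrow> 'w \<Rightarrow> nat \<Rightarrow> 'z" where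
  "block z a k \<omega> = (\<lambda>j\<in>{1..k}. z (a + j) \<omega>)"

definition stationary_process :: "'w measure \<Rightarrow> 'z measure \<Rightarrow> (nat \<Rightarrow> 'w \<Rightarrow> 'z) \<Rightarrow> bool" where
  "stationary_process M MZ z \<longleftrightarrow>
     (\<forall>k s. distr M (tuples k MZ) (block z s k) = distr M (tuples k MZ) (block z 0 k))"

text \<open>Every shift-invariant event of the path space \<open>\<Z>\<^bsup>{1,2,\<dots>}\<^esup>\<close> has probability 0 or 1.\<close>

definition ergodic_process :: "'w measure \<Rightarrow> 'z measure \<Rightarrow> (nat \<Rightarrow> 'w \<Rightarrow> 'z) \<Rightarrow> bool" where
  "ergodic_process M MZ z \<longleftrightarrow>
     (\<forall>A \<in> sets (PiM {1..} (\<lambda>_. MZ)).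
        {p \<in> space (PiM {1..} (\<lambda>_. MZ)). (\<lambda>t\<in>{1..}. p (t + 1)) \<in> A} = A \<longrightarrow>
        measure M {\<omega> \<in> space M. (\<lambda>t\<in>{1..}. z t \<omega>) \<in> A} \<in> {0, 1})"

text \<open>
  Weak law of large numbers for all integrable functions of \<open>k\<close>-blocks, the blocks starting at the
  times \<open>1, 1 + s, 1 + 2 s, \<dots>\<close>. For \<open>s = 1\<close> the average is
  \<open>(1/n) \<Sum>\<^bsub>t=1..n\<^esub> g (z\<^bsub>t:t+k-1\<^esub>)\<close>. The law for \<open>s = 1\<close> does not imply the one for \<open>s \<ge> 2\<close>
  (a periodic process with uniformly random phase is a counterexample).
\<close>

definition weak_lln :: "'w measure \<Rightarrow> 'z measure \<Rightarrow> (nat \<Rightarrow> 'w \<Rightarrow> 'z) \<Rightarrow> nat \<Rightarrow> bool" where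
  "weak_lln M MZ z s \<longleftrightarrow>
     (\<forall>k\<ge>1. \<forall>g \<in> borel_measurable (tuples k MZ).
        integrable M (\<lambda>\<omega>. g (block z 0 k \<omega>)) \<longrightarrow>
        (\<forall>\<epsilon>>0::real.
           (\<lambda>n. measure M {\<omega> \<in> space M.
                  \<bar>(1 / real n) * (\<Sum>t=1..n. g (block z ((t - 1) * s) k \<omega>))
                    - (\<integral>\<omega>'. g (block z 0 k \<omega>') \<partial>M)\<bar> \<ge> \<epsilon>}) \<longlonglongrightarrow> 0))"

definition pinball :: "real \<Rightarrow> real \<Rightarrow> real" where
  "pinball \<beta> t = - t * (of_bool (t \<le> 0) - \<beta>)"

text \<open>
  \<open>val_err \<A> ntr nval z a\<close> is \<open>\<A> (z\<^bsub>a+1:a+ntr\<^esub>, z\<^bsub>a+ntr+1:a+ntr+nval\<^esub>)\<close>.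
  \<open>test_err l fhat ntr nte z c\<close> is the average loss over the test times \<open>c+1, \<dots>, c+nte\<close> of the
  forecaster trained on the \<open>ntr\<close> points immediately before them, \<open>z\<^bsub>c-ntr+1:c\<^esub>\<close>.
\<close>

definition val_err ::
  "((nat \<Rightarrow> 'z) \<times> (nat \<Rightarrow> 'z) \<Rightarrow> real ^ 'm) \<Rightarrow> nat \<Rightarrow> nat \<Rightarrow> (nat \<Rightarrow> 'w \<Rightarrow> 'z) \<Rightarrow>
    nat \<Rightarrow> 'w \<Rightarrow> real ^ 'm" where
  "val_err \<A> ntr nval z a \<omega> = \<A> (block z a ntr \<omega>, block z (a + ntr) nval \<omega>)"

definition test_err ::
  "('y \<times> 'y \<Rightarrow> real) \<Rightarrow> ('x \<times> (nat \<Rightarrow> 'x \<times> 'y) \<Rightarrow> 'y) \<Rightarrow> nat \<Rightarrow> nat \<Rightarrow>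
    (nat \<Rightarrow> 'w \<Rightarrow> 'x \<times> 'y) \<Rightarrow> nat \<Rightarrow> 'w \<Rightarrow> real" where
  "test_err l fhat ntr nte z c \<omega> =
     (1 / real nte) *
       (\<Sum>t\<in>{c+1..c+nte}. l (fhat (fst (z t \<omega>), block z (c - ntr) ntr \<omega>), snd (z t \<omega>)))"

text \<open>The windows: \<open>a\<^sub>i = (i - 1) \<Delta>\<close> for \<open>i = 1, \<dots>, K\<close>; \<open>n\<close> is at least \<open>ntr + nval + nte\<close> in all uses.\<close>

definition num_windows :: "nat \<Rightarrow> nat \<Rightarrow> nat \<Rightarrow> nat \<Rightarrow> nat \<Rightarrow> nat" where
  "num_windows ntr nval nte \<Delta> n = (n - (ntr + nval + nte)) div \<Delta> + 1"

definition win_val where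
  "win_val \<A> ntr nval \<Delta> z i = val_err \<A> ntr nval z ((i - 1) * \<Delta>)"

definition win_test where
  "win_test l fhat ntr nval nte \<Delta> z i = test_err l fhat ntr nte z ((i - 1) * \<Delta> + ntr + nval)"

definition star_val where
  "star_val \<A> ntr nval z n = val_err \<A> ntr nval z (n - ntr - nval)"

definition err_sto where
  "err_sto l fhat ntr nte z n = test_err l fhat ntr nte z n"

text \<open>
  The common law \<open>\<L>\<close> of all pairs (validation error, test error), taken from the first window;
  that every pair has this law for a stationary process is shown below.
\<close>

definition err_law ::
  "'w measure \<Rightarrow> ((nat \<Rightarrow> 'x \<times> 'y) \<times> (nat \<Rightarrow> 'x \<times> 'y) \<Rightarrow> real ^ 'm) \<Rightarrow> ('y \<times> 'y \<Rightarrow> real) \<Rightarrow>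
    ('x \<times> (nat \<Rightarrow> 'x \<times> 'y) \<Rightarrow> 'y) \<Rightarrow> nat \<Rightarrow> nat \<Rightarrow> nat \<Rightarrow> (nat \<Rightarrow> 'w \<Rightarrow> 'x \<times> 'y) \<Rightarrow>
    ((real ^ 'm) \<times> real) measure" where
  "err_law M \<A> l fhat ntr nval nte z =
     distr M borel (\<lambda>\<omega>. (val_err \<A> ntr nval z 0 \<omega>, test_err l fhat ntr nte z (ntr + nval) \<omega>))"

text \<open>
  Population minimizers of the expected pinball loss. Bochner integrals of non-integrable functions
  are 0 by convention, so the minimization has to range over the functions of finite expected loss.
\<close>

definition quantile_class ::
  "real \<Rightarrow> ((real ^ 'm) \<times> real) measure \<Rightarrow> (real ^ 'm \<Rightarrow> real) set" where
  "quantile_class \<beta> L =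
     {f. is_arg_min (\<lambda>g. \<integral>p. pinball \<beta> (snd p - g (fst p)) \<partial>L)
           (\<lambda>g. g \<in> borel_measurable borel \<and> integrable L (\<lambda>p. pinball \<beta> (snd p - g (fst p)))) f}"

definition empirical_risk ::
  "real \<Rightarrow> nat \<Rightarrow> (nat \<Rightarrow> 'v) \<Rightarrow> (nat \<Rightarrow> real) \<Rightarrow> ('v \<Rightarrow> real) \<Rightarrow> real" where
  "empirical_risk \<beta> K v e f = (1 / real K) * (\<Sum>i=1..K. pinball \<beta> (e i - f (v i)))"

text \<open>
  \<open>fh\<close> is a possible outcome of the quantile regression on \<open>z\<^bsub>1:n\<^esub>\<close>: a random element of the class
  \<open>F\<close> that minimizes the empirical risk for every \<open>\<omega>\<close>. Ties may be broken in any measurable way.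
\<close>

definition qfcv_fit ::
  "'w measure \<Rightarrow> ((nat \<Rightarrow> 'x \<times> 'y) \<times> (nat \<Rightarrow> 'x \<times> 'y) \<Rightarrow> real ^ 'm) \<Rightarrow> ('y \<times> 'y \<Rightarrow> real) \<Rightarrow>
    ('x \<times> (nat \<Rightarrow> 'x \<times> 'y) \<Rightarrow> 'y) \<Rightarrow> nat \<Rightarrow> nat \<Rightarrow> nat \<Rightarrow> nat \<Rightarrow> (nat \<Rightarrow> 'w \<Rightarrow> 'x \<times> 'y) \<Rightarrow>
    (real ^ 'm \<Rightarrow> real) set \<Rightarrow> real \<Rightarrow> nat \<Rightarrow> ('w \<Rightarrow> real ^ 'm \<Rightarrow> real) \<Rightarrow> bool" where
  "qfcv_fit M \<A> l fhat ntr nval nte \<Delta> z F \<beta> n fh \<longleftrightarrow>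
     fh \<in> M \<rightarrow>\<^sub>M count_space F \<and>
     (\<forall>\<omega> \<in> space M.
        is_arg_min
          (empirical_risk \<beta> (num_windows ntr nval nte \<Delta> n)
             (\<lambda>i. win_val \<A> ntr nval \<Delta> z i \<omega>) (\<lambda>i. win_test l fhat ntr nval nte \<Delta> z i \<omega>))
          (\<lambda>f. f \<in> F) (fh \<omega>))"

definition qfcv_interval where
  "qfcv_interval \<A> ntr nval z n flo fhi \<omega> =
     {flo \<omega> (star_val \<A> ntr nval z n \<omega>) .. fhi \<omega> (star_val \<A> ntr nval z n \<omega>)}"

lemma measurable_block:
  assumes "\<And>t. t \<ge> 1 \<Longrightarrow> z t \<in> M \<rightarrow>\<^sub>M MZ"
  shows "block z a k \<in> M \<rightarrow>\<^sub>M tuples k MZ"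
  unfolding block_def by (rule measurable_restrict) (simp add: assms)

lemma val_err_block:
  assumes "ntr + nval \<le> N"
  shows "val_err \<A> ntr nval z a \<omega> = val_err \<A> ntr nval (\<lambda>t b. b t) 0 (block z a N \<omega>)"
proof -
  have 1: "block z a ntr \<omega> = block (\<lambda>t b. b t) 0 ntr (block z a N \<omega>)"
    using assms by (auto simp: block_def restrict_def fun_eq_iff)
  have 2: "block z (a + ntr) nval \<omega> = block (\<lambda>t b. b t) (0 + ntr) nval (block z a N \<omega>)"
    using assms by (auto simp: block_def restrict_def fun_eq_iff add_ac)
  show ?thesis unfolding val_err_def 1 2 ..
qed

lemma test_err_block:
  assumes "ntr + nval + nte \<le> N"
  shows "test_err l fhat ntr nte z (a + ntr + nval) \<omega> =
         test_err l fhat ntr nte (\<lambda>t b. b t) (ntr + nval) (block z a N \<omega>)"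
proof -
  have 1: "block z (a + ntr + nval - ntr) ntr \<omega> =
           block (\<lambda>t b. b t) (ntr + nval - ntr) ntr (block z a N \<omega>)"
    using assms by (auto simp: block_def restrict_def fun_eq_iff add_ac)
  have 2: "(\<Sum>t\<in>{a+ntr+nval+1..a+ntr+nval+nte}. h (z t \<omega>)) =
           (\<Sum>t\<in>{ntr+nval+1..ntr+nval+nte}. h (block z a N \<omega> t))" for h :: "_ \<Rightarrow> real"
    using assms
    by (intro sum.reindex_bij_witness[of _ "\<lambda>t. a + t" "\<lambda>t. t - a"]) (auto simp: block_def)
  show ?thesis unfolding test_err_def 1
    using 2[of "\<lambda>p. l (fhat (fst p, block (\<lambda>t b. b t) (ntr + nval - ntr) ntr (block z a N \<omega>)), snd p)"]
    by simp
qed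

lemma measurable_val_err:
  assumes z: "\<And>t. 1 \<le> t \<Longrightarrow> t \<le> a + ntr + nval \<Longrightarrow> z t \<in> M \<rightarrow>\<^sub>M MZ"
    and A: "\<A> \<in> tuples ntr MZ \<Otimes>\<^sub>M tuples nval MZ \<rightarrow>\<^sub>M borel"
  shows "val_err \<A> ntr nval z a \<in> borel_measurable M"
proof -
  have "block z a ntr \<in> M \<rightarrow>\<^sub>M tuples ntr MZ" "block z (a + ntr) nval \<in> M \<rightarrow>\<^sub>M tuples nval MZ"
    unfolding block_def by (rule measurable_restrict, simp add: z)+
  then show ?thesis
    unfolding val_err_def by (intro measurable_compose[OF _ A] measurable_Pair)
qed

lemma measurable_test_err:
  assumes z: "\<And>t. 1 \<le> t \<Longrightarrow> t \<le> c + nte \<Longrightarrow> z t \<in> M \<rightarrow>\<^sub>M MX \<Otimes>\<^sub>M MY"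
    and f: "fhat \<in> MX \<Otimes>\<^sub>M tuples ntr (MX \<Otimes>\<^sub>M MY) \<rightarrow>\<^sub>M MY"
    and l: "l \<in> borel_measurable (MY \<Otimes>\<^sub>M MY)" and c: "ntr \<le> c"
  shows "test_err l fhat ntr nte z c \<in> borel_measurable M"
proof -
  have b: "block z (c - ntr) ntr \<in> M \<rightarrow>\<^sub>M tuples ntr (MX \<Otimes>\<^sub>M MY)"
    unfolding block_def by (rule measurable_restrict) (use c in \<open>auto intro!: z\<close>)
  have "(\<lambda>\<omega>. l (fhat (fst (z t \<omega>), block z (c - ntr) ntr \<omega>), snd (z t \<omega>))) \<in> borel_measurable M"
    if "t \<in> {c+1..c+nte}" for t
  proof -
    have [measurable]: "z t \<in> M \<rightarrow>\<^sub>M MX \<Otimes>\<^sub>M MY" using that by (intro z) auto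
    note [measurable] = b f l
    show ?thesis by measurable
  qed
  then show ?thesis unfolding test_err_def
    by (intro borel_measurable_times borel_measurable_sum) auto
qed

lemma distr_err_pair:
  assumes z: "\<And>t. t \<ge> 1 \<Longrightarrow> z t \<in> M \<rightarrow>\<^sub>M MX \<Otimes>\<^sub>M MY"
    and st: "stationary_process M (MX \<Otimes>\<^sub>M MY) z"
    and f: "fhat \<in> MX \<Otimes>\<^sub>M tuples ntr (MX \<Otimes>\<^sub>M MY) \<rightarrow>\<^sub>M MY"
    and l: "l \<in> borel_measurable (MY \<Otimes>\<^sub>M MY)"
    and A: "\<A> \<in> tuples ntr (MX \<Otimes>\<^sub>M MY) \<Otimes>\<^sub>M tuples nval (MX \<Otimes>\<^sub>M MY) \<rightarrow>\<^sub>M borel"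
  shows "distr M borel (\<lambda>\<omega>. (val_err \<A> ntr nval z a \<omega>, test_err l fhat ntr nte z (a + ntr + nval) \<omega>))
         = err_law M \<A> l fhat ntr nval nte z"
proof -
  define N where "N = ntr + nval + nte"
  let ?T = "tuples N (MX \<Otimes>\<^sub>M MY)"
  define \<Phi> where "\<Phi> = (\<lambda>b. (val_err \<A> ntr nval (\<lambda>t b. b t) 0 b,
                             test_err l fhat ntr nte (\<lambda>t b. b t) (ntr + nval) b))"
  have "\<Phi> \<in> borel_measurable ?T"
    unfolding \<Phi>_def
    by (intro borel_measurable_Pair measurable_val_err[OF _ A] measurable_test_err[OF _ f l])
       (auto simp: N_def)
  have eq: "distr M borel (\<lambda>\<omega>. (val_err \<A> ntr nval z a \<omega>, test_err l fhat ntr nte z (a + ntr + nval) \<omega>))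
        = distr (distr M ?T (block z a N)) borel \<Phi>" for a
  proof -
    have "(\<lambda>\<omega>. (val_err \<A> ntr nval z a \<omega>, test_err l fhat ntr nte z (a + ntr + nval) \<omega>))
          = \<Phi> \<circ> block z a N"
      using val_err_block[of ntr nval N \<A> z a] test_err_block[of ntr nval nte N l fhat z a]
      by (auto simp: \<Phi>_def N_def)
    then show ?thesis
      using distr_distr[OF \<open>\<Phi> \<in> borel_measurable ?T\<close>, of "block z a N" M] measurable_block[OF z]
      by simp
  qed
  have "distr M ?T (block z a N) = distr M ?T (block z 0 N)"
    using st unfolding stationary_process_def by blast
  then show ?thesis
    using eq[of a] eq[of 0] by (simp add: err_law_def)
qed

corollary distr_window_pair:
  assumes "\<And>t. t \<ge> 1 \<Longrightarrow> z t \<in> M \<rightarrow>\<^sub>M MX \<Otimes>\<^sub>M MY"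
    and "stationary_process M (MX \<Otimes>\<^sub>M MY) z"
    and "fhat \<in> MX \<Otimes>\<^sub>M tuples ntr (MX \<Otimes>\<^sub>M MY) \<rightarrow>\<^sub>M MY"
    and "l \<in> borel_measurable (MY \<Otimes>\<^sub>M MY)"
    and "\<A> \<in> tuples ntr (MX \<Otimes>\<^sub>M MY) \<Otimes>\<^sub>M tuples nval (MX \<Otimes>\<^sub>M MY) \<rightarrow>\<^sub>M borel"
  shows "distr M borel (\<lambda>\<omega>. (win_val \<A> ntr nval \<Delta> z i \<omega>, win_test l fhat ntr nval nte \<Delta> z i \<omega>))
         = err_law M \<A> l fhat ntr nval nte z"
  unfolding win_val_def win_test_def by (rule distr_err_pair[OF assms])

corollary distr_star_pair:
  assumes "\<And>t. t \<ge> 1 \<Longrightarrow> z t \<in> M \<rightarrow>\<^sub>M MX \<Otimes>\<^sub>M MY"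
    and "stationary_process M (MX \<Otimes>\<^sub>M MY) z"
    and "fhat \<in> MX \<Otimes>\<^sub>M tuples ntr (MX \<Otimes>\<^sub>M MY) \<rightarrow>\<^sub>M MY"
    and "l \<in> borel_measurable (MY \<Otimes>\<^sub>M MY)"
    and "\<A> \<in> tuples ntr (MX \<Otimes>\<^sub>M MY) \<Otimes>\<^sub>M tuples nval (MX \<Otimes>\<^sub>M MY) \<rightarrow>\<^sub>M borel"
    and "ntr + nval \<le> n"
  shows "distr M borel (\<lambda>\<omega>. (star_val \<A> ntr nval z n \<omega>, err_sto l fhat ntr nte z n \<omega>))
         = err_law M \<A> l fhat ntr nval nte z"
  using distr_err_pair[OF assms(1-5), of "n - ntr - nval" nte] assms(6)
  by (simp add: star_val_def err_sto_def)

end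

theory Submission
  imports Defs
begin

text \<open>
  Every empirical risk converges to the population risk (after truncation of the loss, when the
  latter is infinite), so with probability tending to 1 both fits on the finite class are population
  quantiles. The test error almost surely falls on the same side of any two minimizers of the same
  population risk, so the fitted endpoints may be replaced by fixed ones \<open>f\<close> and \<open>g\<close>. Their
  levels are exactly \<open>\<alpha>/2\<close> and \<open>1 - \<alpha>/2\<close>, because the density rules out an atom on their graphs,
  and \<open>f \<le> g\<close> almost surely, so the coverage is the difference of the levels. All of these
  properties are read off by perturbing the minimizers in the population risk, without
  disintegrating the law into conditional distributions.
\<close>

section \<open>Elementary properties of the pinball loss\<close>

text \<open>A linear term plus a hinge: the level \<open>\<beta>\<close> enters only linearly and
  the convexity sits in the hinge. In the comparison of midpoints the linear terms cancel, in that
  of two levels the hinges do.\<close>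

lemma pinball_eq: "pinball \<beta> t = \<beta> * t + max 0 (- t)"
  by (auto simp: pinball_def algebra_simps max_def)

lemma measurable_pinball [measurable]: "pinball \<beta> \<in> borel_measurable borel"
  unfolding pinball_eq[abs_def] by measurable

text \<open>Coercivity: both slopes of the loss are at least
  \<open>min \<beta> (1 - \<beta>)\<close> in absolute value, so for \<open>0 < \<beta> < 1\<close>
  a finite expected loss controls the first moment of the residual.\<close>

lemma pinball_ge:
  assumes "0 \<le> \<beta>" "\<beta> \<le> 1"
  shows "min \<beta> (1 - \<beta>) * \<bar>t\<bar> \<le> pinball \<beta> t"
proof (cases "t \<le> 0")
  case True
  have "min \<beta> (1 - \<beta>) * \<bar>t\<bar> \<le> (1 - \<beta>) * \<bar>t\<bar>" by (intro mult_right_mono) auto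
  then show ?thesis using True by (simp add: pinball_def algebra_simps)
next
  case False
  have "min \<beta> (1 - \<beta>) * \<bar>t\<bar> \<le> \<beta> * \<bar>t\<bar>" by (intro mult_right_mono) auto
  then show ?thesis using False by (simp add: pinball_def algebra_simps)
qed

lemma pinball_nonneg:
  assumes "0 \<le> \<beta>" "\<beta> \<le> 1"
  shows "0 \<le> pinball \<beta> t"
  using pinball_ge[OF assms, of t] assms
  by (smt (verit) abs_ge_zero min_def mult_nonneg_nonneg)

lemma integrable_pinball_iff:
  assumes \<beta>: "0 < \<beta>" "\<beta> < 1" and X [measurable]: "X \<in> borel_measurable M"
  shows "integrable M (\<lambda>x. pinball \<beta> (X x)) \<longleftrightarrow> integrable M X"
proof
  define c where "c = min \<beta> (1 - \<beta>)"
  have c: "0 < c" using \<beta> by (simp add: c_def)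
  assume "integrable M (\<lambda>x. pinball \<beta> (X x))"
  then have "integrable M (\<lambda>x. pinball \<beta> (X x) / c)" by simp
  then show "integrable M X"
  proof (rule Bochner_Integration.integrable_bound)
    have "\<bar>t\<bar> \<le> pinball \<beta> t / c" for t
      using pinball_ge[of \<beta> t] \<beta> c by (simp add: c_def[symmetric] field_simps)
    then show "AE x in M. norm (X x) \<le> norm (pinball \<beta> (X x) / c)"
      by (intro AE_I2) (metis abs_ge_self order_trans real_norm_def)
  qed simp
next
  assume "integrable M X"
  then show "integrable M (\<lambda>x. pinball \<beta> (X x))"
    unfolding pinball_eq by auto
qed

section \<open>Population quantiles as minimizers of the pinball risk\<close>

text \<open>Finite expected loss amounts to an integrable residual, a condition free of the level
  and stable under the operations that build competitors below: constant shifts, midpoints, minima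
  and maxima.\<close>

lemma quantile_class_iff:
  fixes L :: "((real ^ 'm) \<times> real) measure"
  assumes \<beta>: "0 < \<beta>" "\<beta> < 1" and L: "sets L = sets borel"
  shows "f \<in> quantile_class \<beta> L \<longleftrightarrow>
    f \<in> borel_measurable borel \<and> integrable L (\<lambda>p. snd p - f (fst p)) \<and>
    (\<forall>g. g \<in> borel_measurable borel \<longrightarrow> integrable L (\<lambda>p. snd p - g (fst p)) \<longrightarrow>
       (\<integral>p. pinball \<beta> (snd p - f (fst p)) \<partial>L) \<le> (\<integral>p. pinball \<beta> (snd p - g (fst p)) \<partial>L))"
proof -
  have "integrable L (\<lambda>p. pinball \<beta> (snd p - g (fst p))) \<longleftrightarrow> integrable L (\<lambda>p. snd p - g (fst p))"
    if [measurable]: "g \<in> borel_measurable borel" for g :: "real ^ 'm \<Rightarrow> real"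
  proof (rule integrable_pinball_iff[OF \<beta>])
    show "(\<lambda>p. snd p - g (fst p)) \<in> borel_measurable L"
      unfolding measurable_cong_sets[OF L refl] by (simp add: borel_prod[symmetric])
  qed
  then show ?thesis
    unfolding quantile_class_def is_arg_min_def mem_Collect_eq by (meson not_le)
qed

text \<open>The linear terms cancel, so the midpoint defect does not depend on
  \<open>\<beta>\<close>. It is nonnegative, and positive exactly when \<open>s\<close> and
  \<open>t\<close> have strictly opposite signs.\<close>

lemma pinball_midpoint:
  "pinball \<beta> s + pinball \<beta> t - 2 * pinball \<beta> ((s + t) / 2) =
   max 0 (- s) + max 0 (- t) - max 0 (- (s + t))"
  by (simp add: pinball_eq max_def field_simps)

text \<open>The subgradient inequality of the convex function \<open>pinball \<beta>\<close> at \<open>t - c\<close>.\<close>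

lemma pinball_shift: "pinball \<beta> (t - c) - pinball \<beta> t \<le> c * (of_bool (t \<le> c) - \<beta>)"
  by (simp add: pinball_eq max_def algebra_simps)

text \<open>
  Where \<open>e\<close> lies strictly between \<open>f v\<close> and \<open>g v\<close>, the pinball loss is strictly convex along the
  segment, so \<open>(f + g) / 2\<close> would beat the two minimizers if this happened with positive probability.
\<close>

lemma quantile_class_AE_not_between:
  fixes L :: "((real ^ 'm) \<times> real) measure"
  assumes \<beta>: "0 < \<beta>" "\<beta> < 1" and L: "sets L = sets borel"
    and f: "f \<in> quantile_class \<beta> L" and g: "g \<in> quantile_class \<beta> L"
  shows "AE p in L. \<not> (f (fst p) < snd p \<and> snd p < g (fst p))"
proof -
  note fD = f[unfolded quantile_class_iff[OF \<beta> L]] and gD = g[unfolded quantile_class_iff[OF \<beta> L]]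
  define h where "h = (\<lambda>v. (f v + g v) / 2)"
  have [measurable]: "f \<in> borel_measurable borel" "g \<in> borel_measurable borel"
    using fD gD by auto
  have h_eq: "snd p - h (fst p) = ((snd p - f (fst p)) + (snd p - g (fst p))) / 2" for p :: "(real ^ 'm) \<times> real"
    by (simp add: h_def field_simps)
  have h_int: "integrable L (\<lambda>p. snd p - h (fst p))"
    unfolding h_eq using fD gD by (intro integrable_divide Bochner_Integration.integrable_add) auto
  have hm: "h \<in> borel_measurable borel" unfolding h_def by measurable
  have int: "integrable L (\<lambda>p. pinball \<beta> (snd p - k (fst p)))"
    if "integrable L (\<lambda>p. snd p - k (fst p))" for k :: "real ^ 'm \<Rightarrow> real"
    using that integrable_pinball_iff[OF \<beta>] borel_measurable_integrable by blast
  note ints = int[of f] int[of g] int[of h]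
  define d where "d = (\<lambda>p. pinball \<beta> (snd p - f (fst p)) + pinball \<beta> (snd p - g (fst p))
                            - 2 * pinball \<beta> (snd p - h (fst p)))"
  have d_int: "integrable L d" unfolding d_def using ints fD gD h_int by simp
  have d_eq: "d p = max 0 (f (fst p) - snd p) + max 0 (g (fst p) - snd p)
                     - max 0 ((f (fst p) - snd p) + (g (fst p) - snd p))" for p
    unfolding d_def h_eq pinball_midpoint by simp
  have d_nonneg: "0 \<le> d p" for p unfolding d_eq by (simp add: max_def)
  have "(\<integral>p. d p \<partial>L) = (\<integral>p. pinball \<beta> (snd p - f (fst p)) \<partial>L) + (\<integral>p. pinball \<beta> (snd p - g (fst p)) \<partial>L)
          - 2 * (\<integral>p. pinball \<beta> (snd p - h (fst p)) \<partial>L)"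
    unfolding d_def using ints fD gD h_int by simp
  also have "\<dots> \<le> 0"
  proof -
    have "(\<integral>p. pinball \<beta> (snd p - f (fst p)) \<partial>L) \<le> (\<integral>p. pinball \<beta> (snd p - h (fst p)) \<partial>L)"
         "(\<integral>p. pinball \<beta> (snd p - g (fst p)) \<partial>L) \<le> (\<integral>p. pinball \<beta> (snd p - h (fst p)) \<partial>L)"
      using fD gD hm h_int by blast+
    then show ?thesis by linarith
  qed
  finally have "(\<integral>p. d p \<partial>L) = 0" using Bochner_Integration.integral_nonneg[where M = L and f = d] d_nonneg by (simp add: order_antisym)
  then have "AE p in L. d p = 0"
    using integral_nonneg_eq_0_iff_AE[OF d_int] d_nonneg by simp
  then show ?thesis
    by eventually_elim (auto simp: d_eq max_def split: if_splits)
qed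

text \<open>Minimizers need not agree almost surely: they may differ across a gap of the conditional
  law. What is determined is the side on which the test error falls, since strict betweenness is
  null in both orders and ties are excluded by assumption.\<close>

lemma quantile_class_AE_same_side:
  fixes L :: "((real ^ 'm) \<times> real) measure"
  assumes \<beta>: "0 < \<beta>" "\<beta> < 1" and L: "sets L = sets borel"
    and f: "f \<in> quantile_class \<beta> L" and g: "g \<in> quantile_class \<beta> L"
    and "AE p in L. snd p \<noteq> f (fst p)" "AE p in L. snd p \<noteq> g (fst p)"
  shows "AE p in L. (snd p \<le> f (fst p) \<longleftrightarrow> snd p \<le> g (fst p))"
  using quantile_class_AE_not_between[OF \<beta> L f g] quantile_class_AE_not_between[OF \<beta> L g f] assms(6,7)
  by eventually_elim auto

text \<open>First-order optimality along the shifts \<open>f + c\<close>: positive \<open>c\<close>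
  bound the distribution function of the residual below by \<open>\<beta>\<close>, negative
  \<open>c\<close> bound it above. Letting \<open>c\<close> tend to 0 places \<open>\<beta>\<close>
  between the probabilities of a negative and of a nonpositive residual; without an atom at 0 these
  coincide.\<close>

lemma quantile_class_level:
  fixes L :: "((real ^ 'm) \<times> real) measure"
  assumes \<beta>: "0 < \<beta>" "\<beta> < 1" and L: "sets L = sets borel" and "prob_space L"
    and f: "f \<in> quantile_class \<beta> L" and no_atom: "AE p in L. snd p \<noteq> f (fst p)"
  shows "measure L {p. snd p \<le> f (fst p)} = \<beta>"
proof -
  interpret L: prob_space L by fact
  note fD = f[unfolded quantile_class_iff[OF \<beta> L]]
  have [measurable]: "f \<in> borel_measurable borel" using fD by auto
  have X [measurable]: "(\<lambda>p. snd p - f (fst p)) \<in> borel_measurable L" using fD by auto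
  define X where "X = (\<lambda>p. snd p - f (fst p))"
  have Xm [measurable]: "X \<in> borel_measurable L" unfolding X_def by simp
  have Xi: "integrable L X" using fD by (simp add: X_def)
  have sp: "space L = UNIV" using sets_eq_imp_space_eq[OF L] by simp
  have opt: "(\<integral>p. pinball \<beta> (X p) \<partial>L) \<le> (\<integral>p. pinball \<beta> (X p - c) \<partial>L)" for c
  proof -
    have "(\<lambda>v. f v + c) \<in> borel_measurable borel" by simp
    moreover have eq: "snd p - (f (fst p) + c) = X p - c" for p by (simp add: X_def)
    moreover have "integrable L (\<lambda>p. snd p - (f (fst p) + c))" unfolding eq using Xi by simp
    ultimately have "(\<integral>p. pinball \<beta> (snd p - f (fst p)) \<partial>L)
        \<le> (\<integral>p. pinball \<beta> (snd p - (f (fst p) + c)) \<partial>L)"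
      using fD by blast
    then show ?thesis unfolding eq unfolding X_def .
  qed
  have pin_int: "integrable L (\<lambda>p. pinball \<beta> (X p - c))" for c
    using Xi by (subst integrable_pinball_iff[OF \<beta>]) auto
  define \<mu> where "\<mu> = distr L borel X"
  interpret \<mu>: real_distribution \<mu> unfolding \<mu>_def by (rule L.real_distribution_distr) simp
  \<comment> \<open>The increment of the risk is nonnegative by optimality, and integrating
    \<open>pinball_shift\<close> bounds it above by this product. The sign of \<open>c\<close> then
    decides the direction of the bound on \<open>cdf \<mu> c\<close>.\<close>
  have slope: "0 \<le> c * (cdf \<mu> c - \<beta>)" for c
  proof -
    have int: "integrable L (\<lambda>p. of_bool (X p \<le> c) :: real)"
      by (rule L.integrable_const_bound[where B = 1]) auto
    have "0 \<le> (\<integral>p. pinball \<beta> (X p - c) - pinball \<beta> (X p) \<partial>L)"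
      using opt[of c] pin_int[of c] pin_int[of 0] by simp
    also have "\<dots> \<le> (\<integral>p. c * (of_bool (X p \<le> c) - \<beta>) \<partial>L)"
      using pin_int[of c] pin_int[of 0] int by (intro integral_mono pinball_shift) auto
    also have "\<dots> = c * ((\<integral>p. of_bool (X p \<le> c) \<partial>L) - \<beta>)"
      using int by (simp add: L.prob_space)
    also have "(\<integral>p. of_bool (X p \<le> c) \<partial>L) = (\<integral>p. indicator {p \<in> space L. X p \<le> c} p \<partial>L)"
      by (intro Bochner_Integration.integral_cong) (auto simp: indicator_def)
    also have "\<dots> = cdf \<mu> c"
      by (simp add: cdf_def \<mu>_def measure_distr vimage_def Int_def sp)
    finally show ?thesis .
  qed
  have ge: "\<beta> \<le> cdf \<mu> c" if "c > 0" for c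
    using slope[of c] that by (simp add: zero_le_mult_iff)
  have le: "cdf \<mu> c \<le> \<beta>" if "c < 0" for c
    using slope[of c] that by (simp add: zero_le_mult_iff)
  have "\<beta> \<le> cdf \<mu> 0"
  proof (rule tendsto_lowerbound)
    show "(cdf \<mu> \<longlongrightarrow> cdf \<mu> 0) (at_right 0)"
      using \<mu>.cdf_is_right_cont[of 0] by (simp add: continuous_within)
    show "eventually (\<lambda>c. \<beta> \<le> cdf \<mu> c) (at_right 0)"
      using ge by (auto simp: eventually_at_filter)
  qed simp
  \<comment> \<open>The left limit of the distribution function at 0 is the mass of the open
    half-line; \<open>no_atom\<close> identifies it with the closed one below.\<close>
  moreover have "measure \<mu> {..<0} \<le> \<beta>"
  proof (rule tendsto_upperbound[OF \<mu>.cdf_at_left])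
    show "eventually (\<lambda>c. cdf \<mu> c \<le> \<beta>) (at_left 0)"
      using le by (auto simp: eventually_at_filter)
  qed simp
  moreover have "measure \<mu> {..<0} = measure L {p. snd p \<le> f (fst p)}"
  proof -
    have "measure \<mu> {..<0} = measure L {p \<in> space L. X p < 0}"
      by (simp add: \<mu>_def measure_distr vimage_def Int_def conj_commute)
    also have "\<dots> = measure L {p \<in> space L. X p \<le> 0}"
    proof (rule L.finite_measure_eq_AE)
      show "AE p in L. p \<in> {p \<in> space L. X p < 0} \<longleftrightarrow> p \<in> {p \<in> space L. X p \<le> 0}"
        using no_atom by eventually_elim (auto simp: X_def)
    qed measurable
    finally show ?thesis by (simp add: sp X_def)
  qed
  moreover have "cdf \<mu> 0 = measure L {p. snd p \<le> f (fst p)}"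
    by (simp add: cdf_def \<mu>_def measure_distr vimage_def Int_def sp X_def)
  ultimately show ?thesis by simp
qed

text \<open>
  If \<open>g < f\<close> on a set of positive probability, then exchanging \<open>f\<close> and \<open>g\<close> there, that is, passing
  to \<open>min f g\<close> and \<open>max f g\<close>, lowers the sum of the two risks by \<open>(\<gamma> - \<beta>) E[max 0 (f - g)]\<close>.
\<close>

lemma quantile_class_mono:
  fixes L :: "((real ^ 'm) \<times> real) measure"
  assumes \<beta>: "0 < \<beta>" and \<beta>\<gamma>: "\<beta> < \<gamma>" and \<gamma>: "\<gamma> < 1" and L: "sets L = sets borel"
    and f: "f \<in> quantile_class \<beta> L" and g: "g \<in> quantile_class \<gamma> L"
  shows "AE p in L. f (fst p) \<le> g (fst p)"
proof -
  have b: "\<beta> < 1" "0 < \<gamma>" using assms by auto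
  note fD = f[unfolded quantile_class_iff[OF \<beta> b(1) L]]
    and gD = g[unfolded quantile_class_iff[OF b(2) \<gamma> L]]
  have [measurable]: "f \<in> borel_measurable borel" "g \<in> borel_measurable borel"
    using fD gD by auto
  define lo hi where "lo = (\<lambda>v. min (f v) (g v))" and "hi = (\<lambda>v. max (f v) (g v))"
  have [measurable]: "lo \<in> borel_measurable borel" "hi \<in> borel_measurable borel"
    unfolding lo_def hi_def by measurable
  have lo_eq: "snd p - lo (fst p) = max (snd p - f (fst p)) (snd p - g (fst p))"
    and hi_eq: "snd p - hi (fst p) = min (snd p - f (fst p)) (snd p - g (fst p))"
    for p by (auto simp: lo_def hi_def)
  have ints: "integrable L (\<lambda>p. snd p - f (fst p))" "integrable L (\<lambda>p. snd p - g (fst p))"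
    "integrable L (\<lambda>p. snd p - lo (fst p))" "integrable L (\<lambda>p. snd p - hi (fst p))"
    unfolding lo_eq hi_eq using fD gD by auto
  have pin: "integrable L (\<lambda>p. pinball b (snd p - k (fst p)))"
    if "integrable L (\<lambda>p. snd p - k (fst p))" "0 < b" "b < 1" for b and k :: "real ^ 'm \<Rightarrow> real"
    using that integrable_pinball_iff[of b] borel_measurable_integrable by blast
  note pins = ints[THEN pin, OF \<beta> b(1)] ints[THEN pin, OF b(2) \<gamma>]
  define d where "d = (\<lambda>p. (pinball \<beta> (snd p - f (fst p)) - pinball \<beta> (snd p - lo (fst p)))
                     + (pinball \<gamma> (snd p - g (fst p)) - pinball \<gamma> (snd p - hi (fst p))))"
  \<comment> \<open>At each point \<open>lo\<close> and \<open>hi\<close> are \<open>f\<close> and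
    \<open>g\<close> in some order, so the four hinges cancel and only the linear terms, with
    weights \<open>\<beta>\<close> and \<open>\<gamma>\<close>, remain.\<close>
  have d_eq: "d p = (\<gamma> - \<beta>) * max 0 (f (fst p) - g (fst p))" for p
    unfolding d_def pinball_eq lo_def hi_def by (cases "f (fst p) \<le> g (fst p)") (simp_all add: algebra_simps)
  have d_nonneg: "0 \<le> d p" for p unfolding d_eq using \<beta>\<gamma> by simp
  have d_int: "integrable L d" unfolding d_def using pins by simp
  have "(\<integral>p. pinball \<beta> (snd p - f (fst p)) \<partial>L) \<le> (\<integral>p. pinball \<beta> (snd p - lo (fst p)) \<partial>L)"
       "(\<integral>p. pinball \<gamma> (snd p - g (fst p)) \<partial>L) \<le> (\<integral>p. pinball \<gamma> (snd p - hi (fst p)) \<partial>L)"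
    using fD gD ints by auto
  then have "(\<integral>p. d p \<partial>L) \<le> 0" unfolding d_def using pins by simp
  then have "(\<integral>p. d p \<partial>L) = 0" using Bochner_Integration.integral_nonneg[where M = L and f = d] d_nonneg by (simp add: order_antisym)
  then have "AE p in L. d p = 0"
    using integral_nonneg_eq_0_iff_AE[OF d_int] d_nonneg by simp
  then show ?thesis
    by eventually_elim (use \<beta>\<gamma> in \<open>auto simp: d_eq\<close>)
qed

text \<open>
  For \<open>f\<close> of infinite risk the loss has to be truncated before the law of large numbers applies.
\<close>

lemma truncated_risk_gt:
  fixes L :: "((real ^ 'm) \<times> real) measure"
  assumes \<beta>: "0 < \<beta>" "\<beta> < 1" and L: "sets L = sets borel" and "prob_space L"
    and f0: "f0 \<in> quantile_class \<beta> L" and f: "f \<in> borel_measurable borel" "f \<notin> quantile_class \<beta> L"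
  obtains C :: nat where
    "(\<integral>p. pinball \<beta> (snd p - f0 (fst p)) \<partial>L) < (\<integral>p. min (pinball \<beta> (snd p - f (fst p))) (real C) \<partial>L)"
proof (rule ccontr)
  interpret L: prob_space L by fact
  define R where "R = (\<integral>p. pinball \<beta> (snd p - f0 (fst p)) \<partial>L)"
  define u where "u = (\<lambda>p. pinball \<beta> (snd p - f (fst p)))"
  assume "\<not> thesis"
  then have le: "(\<integral>p. min (u p) (real C) \<partial>L) \<le> R" for C
    using that by (force simp: R_def u_def not_less)
  have [measurable]: "f \<in> borel_measurable borel" by fact
  have X [measurable]: "(\<lambda>p. snd p - f (fst p)) \<in> borel_measurable L"
    unfolding measurable_cong_sets[OF L refl] by (simp add: borel_prod[symmetric])
  then have u [measurable]: "u \<in> borel_measurable L" unfolding u_def by measurable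
  have u0: "0 \<le> u p" for p using \<beta> by (simp add: u_def pinball_nonneg)
  have int: "integrable L (\<lambda>p. min (u p) (real C))" for C
    by (rule L.integrable_const_bound[where B = "real C"]) (use u0 in auto)
  have "incseq (\<lambda>C. \<integral>p. min (u p) (real C) \<partial>L)"
    by (intro incseq_SucI integral_mono int) auto
  then obtain r where r: "(\<lambda>C. \<integral>p. min (u p) (real C) \<partial>L) \<longlonglongrightarrow> r"
    using incseq_convergent[of "\<lambda>C. \<integral>p. min (u p) (real C) \<partial>L" R] le by blast
  have lim: "AE p in L. (\<lambda>C. min (u p) (real C)) \<longlonglongrightarrow> u p"
  proof (intro AE_I2 tendsto_eventually)
    fix p
    show "eventually (\<lambda>C. min (u p) (real C) = u p) sequentially"
      using eventually_ge_at_top[of "nat \<lceil>u p\<rceil>"] by eventually_elim (auto simp: min_def)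
  qed
  have mono': "AE p in L. mono (\<lambda>C. min (u p) (real C))"
    by (intro AE_I2 monoI) auto
  \<comment> \<open>Monotone convergence turns the uniform bound \<open>R\<close> on the truncated
    risks into a finite risk of at most \<open>R\<close>, so \<open>f\<close> would do as well as
    the minimizer \<open>f0\<close>.\<close>
  have u_int: "integrable L u"
    by (rule integrable_monotone_convergence[OF int mono' lim r u])
  have "(\<integral>p. u p \<partial>L) = r"
    by (rule integral_monotone_convergence[OF int mono' lim r u])
  also have "r \<le> R" using LIMSEQ_le_const2[OF r] le by blast
  finally have "(\<integral>p. u p \<partial>L) \<le> R" .
  moreover have "integrable L (\<lambda>p. snd p - f (fst p))"
    using u_int integrable_pinball_iff[OF \<beta> X] by (simp add: u_def)
  ultimately have "f \<in> quantile_class \<beta> L"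
    using f(1) f0 unfolding quantile_class_iff[OF \<beta> L] u_def R_def by (meson order_trans)
  then show False using f(2) by contradiction
qed

text \<open>Every vertical section of the graph is a single point, so the graph is Lebesgue null by
  Fubini. Through this the density of the law excludes mass on the graphs of functions in
  \<open>F\<close>.\<close>

lemma AE_lborel_snd_neq:
  fixes f :: "'a::euclidean_space \<Rightarrow> real"
  assumes [measurable]: "f \<in> borel_measurable borel"
  shows "AE p in lborel. snd p \<noteq> f (fst p)"
proof -
  have "AE p in (lborel :: 'a measure) \<Otimes>\<^sub>M lborel. snd p \<noteq> f (fst p)"
  proof (rule lborel_pair.AE_pair_measure)
    show "{p \<in> space ((lborel :: 'a measure) \<Otimes>\<^sub>M lborel). snd p \<noteq> f (fst p)}
        \<in> sets ((lborel :: 'a measure) \<Otimes>\<^sub>M lborel)"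
      by measurable
    show "AE x in (lborel :: 'a measure). AE y in lborel. snd (x, y) \<noteq> f (fst (x, y))"
      using AE_lborel_singleton by auto
  qed
  then show ?thesis unfolding lborel_prod .
qed

section \<open>Consistency of empirical risk minimization over a finite class\<close>

text \<open>If the fit is some \<open>f\<close> that is no population minimizer, its empirical risk
  is at most that of \<open>f0\<close>, although already its truncated population risk is strictly
  larger than the risk of \<open>f0\<close>. One of two averages is then far from its mean, which
  has vanishing probability; finiteness of \<open>F\<close> allows summing over
  \<open>f\<close>.\<close>

lemma empirical_fit_inconsistent_tendsto_0:
  fixes v :: "nat \<Rightarrow> 'w \<Rightarrow> real ^ 'm" and e :: "nat \<Rightarrow> 'w \<Rightarrow> real"
    and L :: "((real ^ 'm) \<times> real) measure" and K :: "nat \<Rightarrow> nat"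
  assumes M: "prob_space M"
    and \<beta>: "0 < \<beta>" "\<beta> < 1" and L: "sets L = sets borel" and "prob_space L"
    and F: "finite F" "F \<subseteq> borel_measurable borel"
    and f0: "f0 \<in> quantile_class \<beta> L" "f0 \<in> F"
    and meas: "\<And>i. i \<ge> 1 \<Longrightarrow> (\<lambda>\<omega>. (v i \<omega>, e i \<omega>)) \<in> M \<rightarrow>\<^sub>M borel"
    and lln: "\<And>h \<epsilon>. h \<in> borel_measurable borel \<Longrightarrow> integrable L h \<Longrightarrow> \<epsilon> > 0 \<Longrightarrow>
       (\<lambda>n. measure M {\<omega> \<in> space M. \<bar>(1 / real n) * (\<Sum>i=1..n. h (v i \<omega>, e i \<omega>)) - (\<integral>p. h p \<partial>L)\<bar> \<ge> \<epsilon>})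
         \<longlonglongrightarrow> 0"
    and K: "filterlim K at_top sequentially"
    and fh_meas: "\<And>n. n \<ge> n0 \<Longrightarrow> fh n \<in> M \<rightarrow>\<^sub>M count_space F"
    and fh: "\<And>n \<omega>. n \<ge> n0 \<Longrightarrow> \<omega> \<in> space M \<Longrightarrow>
       is_arg_min (empirical_risk \<beta> (K n) (\<lambda>i. v i \<omega>) (\<lambda>i. e i \<omega>)) (\<lambda>f. f \<in> F) (fh n \<omega>)"
  shows "(\<lambda>n. measure M {\<omega> \<in> space M. fh n \<omega> \<notin> quantile_class \<beta> L}) \<longlonglongrightarrow> 0"
proof -
  interpret M: prob_space M by fact
  interpret L: prob_space L by fact
  have lossm: "(\<lambda>p. pinball \<beta> (snd p - f (fst p))) \<in> borel_measurable borel"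
    if [measurable]: "f \<in> borel_measurable borel" for f :: "real ^ 'm \<Rightarrow> real"
    by (simp add: borel_prod[symmetric])
  have avgm: "{\<omega> \<in> space M. \<epsilon> \<le> \<bar>(1 / real n) * (\<Sum>i=1..n. h (v i \<omega>, e i \<omega>)) - a\<bar>} \<in> sets M"
    if [measurable]: "h \<in> borel_measurable borel" for h \<epsilon> n a
  proof -
    have [measurable]: "(\<lambda>\<omega>. \<Sum>i=1..n. h (v i \<omega>, e i \<omega>)) \<in> borel_measurable M"
      by (intro borel_measurable_sum measurable_compose[OF meas]) auto
    show ?thesis by measurable
  qed
  define R where "R = (\<integral>p. pinball \<beta> (snd p - f0 (fst p)) \<partial>L)"
  have single: "(\<lambda>n. measure M {\<omega> \<in> space M. fh n \<omega> = f}) \<longlonglongrightarrow> 0"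
    if f: "f \<in> F - quantile_class \<beta> L" for f
  proof -
    have fm: "f \<in> borel_measurable borel" "f0 \<in> borel_measurable borel" using f f0 F by auto
    obtain C :: nat where C: "R < (\<integral>p. min (pinball \<beta> (snd p - f (fst p))) (real C) \<partial>L)"
      using truncated_risk_gt[OF \<beta> L \<open>prob_space L\<close> f0(1) fm(1)] f unfolding R_def by auto
    define h where "h = (\<lambda>p. min (pinball \<beta> (snd p - f (fst p))) (real C))"
    define h0 where "h0 = (\<lambda>p. pinball \<beta> (snd p - f0 (fst p)))"
    have hm [measurable]: "h \<in> borel_measurable borel" "h0 \<in> borel_measurable borel"
      unfolding h_def h0_def using lossm[OF fm(1)] lossm[OF fm(2)] by auto
    have hL: "h \<in> borel_measurable L" unfolding measurable_cong_sets[OF L refl] by simp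
    have hi: "integrable L h"
      by (rule L.integrable_const_bound[where B = "real C", OF _ hL])
         (use \<beta> in \<open>auto simp: h_def pinball_nonneg\<close>)
    have h0i: "integrable L h0"
      using f0(1) unfolding h0_def quantile_class_def is_arg_min_def by auto
    \<comment> \<open>Half of the gap between the two population values: two errors below
      \<open>\<epsilon>\<close> cannot reverse their order.\<close>
    define \<epsilon> where "\<epsilon> = ((\<integral>p. h p \<partial>L) - R) / 2"
    have \<epsilon>: "\<epsilon> > 0" using C by (simp add: \<epsilon>_def h_def)
    define B where "B = (\<lambda>g n. {\<omega> \<in> space M. \<epsilon> \<le> \<bar>(1 / real n) * (\<Sum>i=1..n. g (v i \<omega>, e i \<omega>)) - (\<integral>p. g p \<partial>L)\<bar>})"
    have sub: "{\<omega> \<in> space M. fh n \<omega> = f} \<subseteq> B h (K n) \<union> B h0 (K n)" if n: "n \<ge> n0" for n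
    proof (rule ccontr)
      let ?avg = "\<lambda>g \<omega>. (1 / real (K n)) * (\<Sum>i=1..K n. g (v i \<omega>, e i \<omega>))"
      assume "\<not> ?thesis"
      then obtain \<omega> where \<omega>: "\<omega> \<in> space M" "fh n \<omega> = f"
        and notB: "\<omega> \<notin> B h (K n)" "\<omega> \<notin> B h0 (K n)" by blast
      have 1: "\<bar>?avg h \<omega> - (\<integral>p. h p \<partial>L)\<bar> < \<epsilon>" using notB(1) \<omega>(1) by (simp add: B_def not_le)
      have 2: "\<bar>?avg h0 \<omega> - R\<bar> < \<epsilon>" using notB(2) \<omega>(1) by (simp add: B_def not_le R_def h0_def)
      \<comment> \<open>Truncation only lowers the empirical risk, so the chain keeps its direction
        although the fit minimizes the untruncated loss. The loss of \<open>f0\<close> is integrable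
        and stays untruncated.\<close>
      have "?avg h \<omega> \<le> empirical_risk \<beta> (K n) (\<lambda>i. v i \<omega>) (\<lambda>i. e i \<omega>) f"
        unfolding empirical_risk_def h_def by (intro mult_left_mono sum_mono) auto
      also have "\<dots> \<le> empirical_risk \<beta> (K n) (\<lambda>i. v i \<omega>) (\<lambda>i. e i \<omega>) f0"
        using fh[OF n \<omega>(1)] \<omega>(2) f0(2) by (auto simp: is_arg_min_def not_less)
      also have "\<dots> = ?avg h0 \<omega>" by (simp add: empirical_risk_def h0_def)
      finally show False using 1 2 unfolding \<epsilon>_def by argo
    qed
    have Bset: "B g n \<in> sets M" if "g \<in> borel_measurable borel" for g n
      unfolding B_def by (rule avgm[OF that])
    have Blim: "(\<lambda>n. measure M (B g (K n))) \<longlonglongrightarrow> 0" if "g \<in> borel_measurable borel" "integrable L g" for g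
      unfolding B_def by (rule filterlim_compose[OF lln[OF that \<epsilon>] K])
    have lim: "(\<lambda>n. measure M (B h (K n)) + measure M (B h0 (K n))) \<longlonglongrightarrow> 0"
      using tendsto_add[OF Blim[OF hm(1) hi] Blim[OF hm(2) h0i]] by simp
    show ?thesis
    proof (rule tendsto_sandwich[OF _ _ tendsto_const lim])
      show "eventually (\<lambda>n. measure M {\<omega> \<in> space M. fh n \<omega> = f}
              \<le> measure M (B h (K n)) + measure M (B h0 (K n))) sequentially"
        using eventually_ge_at_top[of n0]
      proof eventually_elim
        case (elim n)
        have "measure M {\<omega> \<in> space M. fh n \<omega> = f} \<le> measure M (B h (K n) \<union> B h0 (K n))"
          using sub[OF elim] Bset hm by (intro M.finite_measure_mono) auto
        also have "\<dots> \<le> measure M (B h (K n)) + measure M (B h0 (K n))"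
          using Bset hm by (intro measure_Un_le) auto
        finally show ?case .
      qed
    qed simp
  qed
  have lim: "(\<lambda>n. \<Sum>f\<in>F - quantile_class \<beta> L. measure M {\<omega> \<in> space M. fh n \<omega> = f}) \<longlonglongrightarrow> 0"
    by (rule tendsto_null_sum[OF single])
  show ?thesis
  proof (rule tendsto_cong[THEN iffD2, OF _ lim])
    show "eventually (\<lambda>n. measure M {\<omega> \<in> space M. fh n \<omega> \<notin> quantile_class \<beta> L}
       = (\<Sum>f\<in>F - quantile_class \<beta> L. measure M {\<omega> \<in> space M. fh n \<omega> = f})) sequentially"
      using eventually_ge_at_top[of n0]
    proof eventually_elim
      case (elim n)
      have "{\<omega> \<in> space M. fh n \<omega> \<notin> quantile_class \<beta> L}
          = (\<Union>f\<in>F - quantile_class \<beta> L. {\<omega> \<in> space M. fh n \<omega> = f})"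
        using fh[OF elim] by (auto simp: is_arg_min_def)
      moreover have "{\<omega> \<in> space M. fh n \<omega> = f} \<in> sets M" if "f \<in> F" for f
        using measurable_sets[OF fh_meas[OF elim], of "{f}"] that
        by (simp add: vimage_def Int_def conj_commute)
      ultimately show ?case
        using F(1) by (simp only:) (intro M.finite_measure_finite_Union, auto simp: disjoint_family_on_def)
    qed
  qed
qed

section \<open>Law of large numbers for the windows\<close>

text \<open>Both errors of window \<open>i\<close> are one fixed function of the block of length
  \<open>ntr + nval + nte\<close> at offset \<open>(i - 1) * \<Delta>\<close>. Window averages are
  therefore block averages of stride \<open>\<Delta>\<close>.\<close>

lemma window_lln:
  fixes z :: "nat \<Rightarrow> 'w \<Rightarrow> 'x \<times> 'y"
    and \<A> :: "(nat \<Rightarrow> 'x \<times> 'y) \<times> (nat \<Rightarrow> 'x \<times> 'y) \<Rightarrow> real ^ 'm"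
  assumes z: "\<And>t. t \<ge> 1 \<Longrightarrow> z t \<in> M \<rightarrow>\<^sub>M MX \<Otimes>\<^sub>M MY"
    and f: "fhat \<in> MX \<Otimes>\<^sub>M tuples ntr (MX \<Otimes>\<^sub>M MY) \<rightarrow>\<^sub>M MY"
    and l: "l \<in> borel_measurable (MY \<Otimes>\<^sub>M MY)"
    and A: "\<A> \<in> borel_measurable (tuples ntr (MX \<Otimes>\<^sub>M MY) \<Otimes>\<^sub>M tuples nval (MX \<Otimes>\<^sub>M MY))"
    and lln: "weak_lln M (MX \<Otimes>\<^sub>M MY) z \<Delta>"
    and "nte \<ge> 1"
    and h: "h \<in> borel_measurable borel" "integrable (err_law M \<A> l fhat ntr nval nte z) h"
    and \<epsilon>: "\<epsilon> > 0"
  shows "(\<lambda>n. measure M {\<omega> \<in> space M.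
      \<bar>(1 / real n) * (\<Sum>i=1..n. h (win_val \<A> ntr nval \<Delta> z i \<omega>, win_test l fhat ntr nval nte \<Delta> z i \<omega>))
         - (\<integral>p. h p \<partial>err_law M \<A> l fhat ntr nval nte z)\<bar> \<ge> \<epsilon>}) \<longlonglongrightarrow> 0"
proof -
  define N where "N = ntr + nval + nte"
  \<comment> \<open>The process \<open>\<lambda>t b. b t\<close> has the tuple itself as its sample
    point, so the error functions of a process also serve as functions of a single block.\<close>
  define \<Phi> where "\<Phi> = (\<lambda>b. (val_err \<A> ntr nval (\<lambda>t b. b t) 0 b,
                             test_err l fhat ntr nte (\<lambda>t b. b t) (ntr + nval) b))"
  have \<Phi>: "\<Phi> \<in> borel_measurable (tuples N (MX \<Otimes>\<^sub>M MY))"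
    unfolding \<Phi>_def
    by (intro borel_measurable_Pair measurable_val_err[OF _ A] measurable_test_err[OF _ f l])
       (auto simp: N_def)
  have \<Phi>_block: "\<Phi> (block z a N \<omega>) = (val_err \<A> ntr nval z a \<omega>, test_err l fhat ntr nte z (a + ntr + nval) \<omega>)"
    for a \<omega>
    using val_err_block[of ntr nval N \<A> z a] test_err_block[of ntr nval nte N l fhat z a]
    by (auto simp: \<Phi>_def N_def)
  have law: "err_law M \<A> l fhat ntr nval nte z = distr M borel (\<lambda>\<omega>. \<Phi> (block z 0 N \<omega>))"
    unfolding \<Phi>_block err_law_def by simp
  have m: "(\<lambda>\<omega>. \<Phi> (block z 0 N \<omega>)) \<in> borel_measurable M"
    by (rule measurable_compose[OF measurable_block[OF z] \<Phi>])
  have "(\<lambda>b. h (\<Phi> b)) \<in> borel_measurable (tuples N (MX \<Otimes>\<^sub>M MY))"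
    by (rule measurable_compose[OF \<Phi> h(1)])
  moreover have "integrable M (\<lambda>\<omega>. h (\<Phi> (block z 0 N \<omega>)))"
    using h(2) unfolding law by (simp add: integrable_distr_eq[OF m h(1)])
  moreover have "N \<ge> 1" using \<open>nte \<ge> 1\<close> by (simp add: N_def)
  moreover have law_int: "(\<integral>p. h p \<partial>err_law M \<A> l fhat ntr nval nte z) = (\<integral>\<omega>. h (\<Phi> (block z 0 N \<omega>)) \<partial>M)"
    unfolding law by (rule integral_distr[OF m h(1)])
  ultimately show ?thesis
    using lln[unfolded weak_lln_def, rule_format, of N "\<lambda>b. h (\<Phi> b)", OF _ _ _ \<epsilon>]
    unfolding law_int \<Phi>_block win_val_def win_test_def by simp
qed

section \<open>Coverage of the interval with fitted endpoints\<close>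

theorem theorem3p1:
  fixes M :: "'w measure" and MX :: "'x measure" and MY :: "'y measure"
    and z :: "nat \<Rightarrow> 'w \<Rightarrow> 'x \<times> 'y"
    and ntr nval nte \<Delta> :: nat
    and fhat :: "'x \<times> (nat \<Rightarrow> 'x \<times> 'y) \<Rightarrow> 'y"
    and l :: "'y \<times> 'y \<Rightarrow> real"
    and \<A> :: "(nat \<Rightarrow> 'x \<times> 'y) \<times> (nat \<Rightarrow> 'x \<times> 'y) \<Rightarrow> real ^ 'm"
    and F :: "(real ^ 'm \<Rightarrow> real) set"
    and flo fhi :: "nat \<Rightarrow> 'w \<Rightarrow> real ^ 'm \<Rightarrow> real"
    and \<alpha> :: real
  assumes "0 < \<alpha>" "\<alpha> < 1"
    and "ntr \<ge> 1" "nval \<ge> 1" "nte \<ge> 1" "\<Delta> \<ge> 1"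
    and "prob_space M"
    and "\<And>t. t \<ge> 1 \<Longrightarrow> z t \<in> M \<rightarrow>\<^sub>M MX \<Otimes>\<^sub>M MY"
    and "fhat \<in> MX \<Otimes>\<^sub>M tuples ntr (MX \<Otimes>\<^sub>M MY) \<rightarrow>\<^sub>M MY"
    and "l \<in> borel_measurable (MY \<Otimes>\<^sub>M MY)"
    and "\<A> \<in> borel_measurable (tuples ntr (MX \<Otimes>\<^sub>M MY) \<Otimes>\<^sub>M tuples nval (MX \<Otimes>\<^sub>M MY))"
    and stationary: "stationary_process M (MX \<Otimes>\<^sub>M MY) z"
    and ergodic: "ergodic_process M (MX \<Otimes>\<^sub>M MY) z"
    and lln: "weak_lln M (MX \<Otimes>\<^sub>M MY) z 1"
    and lln_stride: "weak_lln M (MX \<Otimes>\<^sub>M MY) z \<Delta>"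
    and has_density: "\<exists>d \<in> borel_measurable borel.
           err_law M \<A> l fhat ntr nval nte z = density lborel d"
    and "finite F" "F \<subseteq> borel_measurable borel"
    and "quantile_class (\<alpha> / 2) (err_law M \<A> l fhat ntr nval nte z) \<inter> F \<noteq> {}"
    and "quantile_class (1 - \<alpha> / 2) (err_law M \<A> l fhat ntr nval nte z) \<inter> F \<noteq> {}"
    and "\<And>n. n \<ge> ntr + nval + nte \<Longrightarrow>
           qfcv_fit M \<A> l fhat ntr nval nte \<Delta> z F (\<alpha> / 2) n (flo n)"
    and "\<And>n. n \<ge> ntr + nval + nte \<Longrightarrow>
           qfcv_fit M \<A> l fhat ntr nval nte \<Delta> z F (1 - \<alpha> / 2) n (fhi n)"
  shows "(\<lambda>n. measure M {\<omega> \<in> space M. err_sto l fhat ntr nte z n \<omega>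
            \<in> qfcv_interval \<A> ntr nval z n (flo n) (fhi n) \<omega>}) \<longlonglongrightarrow> 1 - \<alpha>"
proof -
  let ?L = "err_law M \<A> l fhat ntr nval nte z"
  let ?N = "ntr + nval + nte"
  let ?K = "num_windows ntr nval nte \<Delta>"
  let ?v = "win_val \<A> ntr nval \<Delta> z" and ?e = "win_test l fhat ntr nval nte \<Delta> z"
  let ?V = "star_val \<A> ntr nval z" and ?E = "err_sto l fhat ntr nte z"
  let ?lo = "quantile_class (\<alpha> / 2) ?L" and ?hi = "quantile_class (1 - \<alpha> / 2) ?L"
  have z: "\<And>t. t \<ge> 1 \<Longrightarrow> z t \<in> M \<rightarrow>\<^sub>M MX \<Otimes>\<^sub>M MY" by fact
  have fhat: "fhat \<in> MX \<Otimes>\<^sub>M tuples ntr (MX \<Otimes>\<^sub>M MY) \<rightarrow>\<^sub>M MY" by fact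
  have l: "l \<in> borel_measurable (MY \<Otimes>\<^sub>M MY)" by fact
  have A: "\<A> \<in> borel_measurable (tuples ntr (MX \<Otimes>\<^sub>M MY) \<Otimes>\<^sub>M tuples nval (MX \<Otimes>\<^sub>M MY))" by fact
  interpret M: prob_space M by fact
  have L: "sets ?L = sets borel" by (simp add: err_law_def)
  have pair_meas: "(\<lambda>\<omega>. (val_err \<A> ntr nval z a \<omega>, test_err l fhat ntr nte z (a + ntr + nval) \<omega>)) \<in> borel_measurable M" for a
    by (intro borel_measurable_Pair measurable_val_err[OF z A] measurable_test_err[OF z fhat l]) auto
  have star_meas: "?V n \<in> borel_measurable M" "?E n \<in> borel_measurable M" if "n \<ge> ?N" for n
    unfolding star_val_def err_sto_def using that
    by (intro measurable_val_err[OF z A] measurable_test_err[OF z fhat l]; simp)+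
  have pL: "prob_space ?L"
    unfolding err_law_def using pair_meas[of 0] by (intro M.prob_space_distr) simp
  interpret L: prob_space ?L by (rule pL)
  have \<beta>: "0 < \<alpha> / 2" "\<alpha> / 2 < 1" "0 < 1 - \<alpha> / 2" "1 - \<alpha> / 2 < 1" "\<alpha> / 2 < 1 - \<alpha> / 2"
    using \<open>0 < \<alpha>\<close> \<open>\<alpha> < 1\<close> by auto
  have no_atom: "AE p in ?L. snd p \<noteq> f (fst p)" if f: "f \<in> F" for f
  proof -
    have ae: "AE p in lborel. snd p \<noteq> f (fst p)"
      by (rule AE_lborel_snd_neq) (use f \<open>F \<subseteq> borel_measurable borel\<close> in auto)
    obtain d where d: "d \<in> borel_measurable borel" "?L = density lborel d"
      using has_density by blast
    have "AE p in density lborel d. snd p \<noteq> f (fst p)"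
      using ae by (subst AE_density) (use d(1) in \<open>auto elim: eventually_mono\<close>)
    then show ?thesis by (simp only: d(2))
  qed
  obtain f g where f: "f \<in> ?lo" "f \<in> F" and g: "g \<in> ?hi" "g \<in> F"
    using \<open>?lo \<inter> F \<noteq> {}\<close> \<open>?hi \<inter> F \<noteq> {}\<close> by blast
  have Fm: "h \<in> borel_measurable borel" if "h \<in> F" for h
    using that \<open>F \<subseteq> borel_measurable borel\<close> by blast
  note [measurable] = Fm[OF f(2)] Fm[OF g(2)]

  have K: "filterlim ?K at_top sequentially"
  proof (rule filterlim_at_top_mono)
    show "filterlim (\<lambda>n. (n - ?N) div \<Delta>) at_top sequentially"
      unfolding filterlim_at_top
    proof
      fix k
      show "eventually (\<lambda>n. k \<le> (n - ?N) div \<Delta>) sequentially"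
        using eventually_ge_at_top[of "k * \<Delta> + ?N"]
      proof eventually_elim
        case (elim n)
        then show ?case using \<open>\<Delta> \<ge> 1\<close> by (simp add: less_eq_div_iff_mult_less_eq)
      qed
    qed
  qed (simp add: num_windows_def)
  have pair_win: "(\<lambda>\<omega>. (?v i \<omega>, ?e i \<omega>)) \<in> borel_measurable M" for i
    unfolding win_val_def win_test_def by (rule pair_meas)
  note wlln = window_lln[OF z fhat l A lln_stride \<open>nte \<ge> 1\<close>]
  \<comment> \<open>The fits are specified only once \<open>n\<close> reaches the length
    \<open>?N\<close> of a full window, hence the threshold.\<close>
  have lo_lim: "(\<lambda>n. measure M {\<omega> \<in> space M. flo n \<omega> \<notin> ?lo}) \<longlonglongrightarrow> 0"
    using assms(21) unfolding qfcv_fit_def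
    by (intro empirical_fit_inconsistent_tendsto_0[OF \<open>prob_space M\<close> \<beta>(1,2) L pL \<open>finite F\<close>
          \<open>F \<subseteq> borel_measurable borel\<close> f pair_win wlln K, where ?n0.0 = ?N]) auto
  have hi_lim: "(\<lambda>n. measure M {\<omega> \<in> space M. fhi n \<omega> \<notin> ?hi}) \<longlonglongrightarrow> 0"
    using assms(22) unfolding qfcv_fit_def
    by (intro empirical_fit_inconsistent_tendsto_0[OF \<open>prob_space M\<close> \<beta>(3,4) L pL \<open>finite F\<close>
          \<open>F \<subseteq> borel_measurable borel\<close> g pair_win wlln K, where ?n0.0 = ?N]) auto

  have spL: "space ?L = UNIV" using sets_eq_imp_space_eq[OF L] by simp
  have below: "{p. snd p \<le> h (fst p)} \<in> sets ?L" if [measurable]: "h \<in> borel_measurable borel" for h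
  proof -
    have "{p \<in> space (borel \<Otimes>\<^sub>M borel). snd p \<le> h (fst p)} \<in> sets (borel \<Otimes>\<^sub>M (borel :: real measure))"
      by measurable
    then show ?thesis unfolding L borel_prod by simp
  qed
  note below_fg = below[OF Fm[OF f(2)]] below[OF Fm[OF g(2)]]
  have target: "measure ?L {p. f (fst p) < snd p \<and> snd p \<le> g (fst p)} = 1 - \<alpha>"
  proof -
    have "measure ?L {p. f (fst p) < snd p \<and> snd p \<le> g (fst p)}
        = measure ?L ({p. snd p \<le> g (fst p)} - {p. snd p \<le> f (fst p)})"
      by (rule arg_cong[where f = "measure ?L"]) auto
    also have "\<dots> = measure ?L {p. snd p \<le> g (fst p)} - measure ?L ({p. snd p \<le> g (fst p)} \<inter> {p. snd p \<le> f (fst p)})"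
      by (rule L.finite_measure_Diff') (rule below_fg)+
    \<comment> \<open>Since \<open>f \<le> g\<close> almost surely, the lower event lies in the
      upper one up to a null set, and the probability of the difference becomes a difference of
      levels.\<close>
    also have "measure ?L ({p. snd p \<le> g (fst p)} \<inter> {p. snd p \<le> f (fst p)}) = measure ?L {p. snd p \<le> f (fst p)}"
    proof (rule L.finite_measure_eq_AE)
      show "AE p in ?L. p \<in> {p. snd p \<le> g (fst p)} \<inter> {p. snd p \<le> f (fst p)} \<longleftrightarrow> p \<in> {p. snd p \<le> f (fst p)}"
        using quantile_class_mono[OF \<beta>(1,5,4) L f(1) g(1)] by eventually_elim auto
    qed (intro sets.Int below_fg)+
    also have "measure ?L {p. snd p \<le> g (fst p)} = 1 - \<alpha> / 2"
      by (rule quantile_class_level[OF \<beta>(3,4) L pL g(1) no_atom[OF g(2)]])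
    also have "measure ?L {p. snd p \<le> f (fst p)} = \<alpha> / 2"
      by (rule quantile_class_level[OF \<beta>(1,2) L pL f(1) no_atom[OF f(2)]])
    finally show ?thesis by simp
  qed

  \<comment> \<open>Coverage by the fixed endpoints, coverage by the fitted ones, and failure of a
    fit to be a population quantile. \<open>S n\<close> is open on the left to be a difference of
    two lower events; the left endpoint in \<open>C n\<close> is hit with probability 0.\<close>
  define S where "S = (\<lambda>n. {\<omega> \<in> space M. f (?V n \<omega>) < ?E n \<omega> \<and> ?E n \<omega> \<le> g (?V n \<omega>)})"
  define C where "C = (\<lambda>n. {\<omega> \<in> space M. ?E n \<omega> \<in> qfcv_interval \<A> ntr nval z n (flo n) (fhi n) \<omega>})"
  define B where "B = (\<lambda>n. {\<omega> \<in> space M. flo n \<omega> \<notin> ?lo} \<union> {\<omega> \<in> space M. fhi n \<omega> \<notin> ?hi})"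
  have close: "\<bar>measure M (C n) - (1 - \<alpha>)\<bar> \<le> measure M (B n)" if n: "n \<ge> ?N" for n
  proof -
    note [measurable] = star_meas[OF n]
    have fit_meas: "flo n \<in> M \<rightarrow>\<^sub>M count_space F" "fhi n \<in> M \<rightarrow>\<^sub>M count_space F"
      using assms(21,22)[OF n] unfolding qfcv_fit_def by auto
    then have fit_F: "flo n \<omega> \<in> F" "fhi n \<omega> \<in> F" if "\<omega> \<in> space M" for \<omega>
      using that by (auto dest: measurable_space)
    have fit_set: "{\<omega> \<in> space M. P (flo n \<omega>)} \<in> sets M" "{\<omega> \<in> space M. P (fhi n \<omega>)} \<in> sets M" for P
    proof -
      have *: "{h \<in> space (count_space F). P h} \<in> sets (count_space F)" by auto
      show "{\<omega> \<in> space M. P (flo n \<omega>)} \<in> sets M" "{\<omega> \<in> space M. P (fhi n \<omega>)} \<in> sets M"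
        using measurable_sets_Collect[OF fit_meas(1) *] measurable_sets_Collect[OF fit_meas(2) *] .
    qed
    have B_set: "B n \<in> sets M" unfolding B_def by (intro sets.Un fit_set)
    have S_set: "S n \<in> sets M" unfolding S_def by measurable
    \<comment> \<open>Evaluating a random function at a random point need not be measurable in
      general; here it reduces to the finitely many possible pairs of fits.\<close>
    have C_set: "C n \<in> sets M"
    proof -
      have "C n = (\<Union>h\<in>F. \<Union>k\<in>F. {\<omega> \<in> space M. flo n \<omega> = h} \<inter> {\<omega> \<in> space M. fhi n \<omega> = k} \<inter>
                {\<omega> \<in> space M. h (?V n \<omega>) \<le> ?E n \<omega> \<and> ?E n \<omega> \<le> k (?V n \<omega>)})"
        using fit_F by (auto simp: C_def qfcv_interval_def)
      moreover have "{\<omega> \<in> space M. h (?V n \<omega>) \<le> ?E n \<omega> \<and> ?E n \<omega> \<le> k (?V n \<omega>)} \<in> sets M"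
        if "h \<in> F" "k \<in> F" for h k
      proof -
        note [measurable] = Fm[OF that(1)] Fm[OF that(2)]
        show ?thesis by measurable
      qed
      ultimately show ?thesis
        using \<open>finite F\<close> by (simp only:) (intro sets.finite_UN sets.Int fit_set; simp)
    qed
    have pm: "(\<lambda>\<omega>. (?V n \<omega>, ?E n \<omega>)) \<in> M \<rightarrow>\<^sub>M borel" by measurable
    have law: "distr M borel (\<lambda>\<omega>. (?V n \<omega>, ?E n \<omega>)) = ?L"
      using distr_star_pair[OF z stationary fhat l A, of n nte] n by simp
    \<comment> \<open>By stationarity the final pair of errors has law \<open>?L\<close> for each
      such \<open>n\<close>, so the coverage with fixed endpoints is exact and not merely
      asymptotic.\<close>
    have prob_S: "measure M (S n) = 1 - \<alpha>"
    proof -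
      have "{p \<in> space (borel \<Otimes>\<^sub>M borel). f (fst p) < snd p \<and> snd p \<le> g (fst p)}
          \<in> sets (borel \<Otimes>\<^sub>M (borel :: real measure))"
        by measurable
      then have "{p. f (fst p) < snd p \<and> snd p \<le> g (fst p)} \<in> sets (borel :: ((real ^ 'm) \<times> real) measure)"
        unfolding borel_prod by simp
      then have "measure ?L {p. f (fst p) < snd p \<and> snd p \<le> g (fst p)} =
          measure M ((\<lambda>\<omega>. (?V n \<omega>, ?E n \<omega>)) -` {p. f (fst p) < snd p \<and> snd p \<le> g (fst p)} \<inter> space M)"
        unfolding law[symmetric] by (rule measure_distr[OF pm])
      also have "(\<lambda>\<omega>. (?V n \<omega>, ?E n \<omega>)) -` {p. f (fst p) < snd p \<and> snd p \<le> g (fst p)} \<inter> space M = S n"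
        by (auto simp: S_def)
      finally show ?thesis using target by (rule trans[OF sym])
    qed
    have to_M: "AE \<omega> in M. P (?V n \<omega>, ?E n \<omega>)" if "AE p in ?L. P p" for P
      by (rule AE_distrD[OF pm, unfolded law, OF that])
    \<comment> \<open>The fits may depend on the final validation error, so the null sets are
      discarded for all candidates in \<open>F\<close> at once, finitely many, before the random
      fits are inserted.\<close>
    have "AE p in ?L. (\<forall>h\<in>F. snd p \<noteq> h (fst p)) \<and>
        (\<forall>h\<in>?lo \<inter> F. snd p \<le> h (fst p) \<longleftrightarrow> snd p \<le> f (fst p)) \<and>
        (\<forall>h\<in>?hi \<inter> F. snd p \<le> h (fst p) \<longleftrightarrow> snd p \<le> g (fst p))"
    proof (intro AE_conjI AE_finite_allI)
      show "AE p in ?L. snd p \<le> h (fst p) \<longleftrightarrow> snd p \<le> f (fst p)" if "h \<in> ?lo \<inter> F" for h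
        using that f by (intro quantile_class_AE_same_side[OF \<beta>(1,2) L] no_atom) auto
      show "AE p in ?L. snd p \<le> h (fst p) \<longleftrightarrow> snd p \<le> g (fst p)" if "h \<in> ?hi \<inter> F" for h
        using that g by (intro quantile_class_AE_same_side[OF \<beta>(3,4) L] no_atom) auto
    qed (simp_all add: \<open>finite F\<close> no_atom)
    from to_M[OF this] have agree: "AE \<omega> in M. \<omega> \<notin> B n \<longrightarrow> (\<omega> \<in> C n \<longleftrightarrow> \<omega> \<in> S n)"
    proof (rule AE_mp, intro AE_I2 impI)
      fix \<omega>
      assume \<omega>: "\<omega> \<in> space M" "\<omega> \<notin> B n"
        and *: "(\<forall>h\<in>F. snd (?V n \<omega>, ?E n \<omega>) \<noteq> h (fst (?V n \<omega>, ?E n \<omega>))) \<and>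
        (\<forall>h\<in>?lo \<inter> F. snd (?V n \<omega>, ?E n \<omega>) \<le> h (fst (?V n \<omega>, ?E n \<omega>)) \<longleftrightarrow> snd (?V n \<omega>, ?E n \<omega>) \<le> f (fst (?V n \<omega>, ?E n \<omega>))) \<and>
        (\<forall>h\<in>?hi \<inter> F. snd (?V n \<omega>, ?E n \<omega>) \<le> h (fst (?V n \<omega>, ?E n \<omega>)) \<longleftrightarrow> snd (?V n \<omega>, ?E n \<omega>) \<le> g (fst (?V n \<omega>, ?E n \<omega>)))"
      have in_classes: "flo n \<omega> \<in> ?lo \<inter> F" "fhi n \<omega> \<in> ?hi \<inter> F"
        using \<omega> fit_F by (auto simp: B_def)
      then have "?E n \<omega> \<noteq> flo n \<omega> (?V n \<omega>)"
        "?E n \<omega> \<le> flo n \<omega> (?V n \<omega>) \<longleftrightarrow> ?E n \<omega> \<le> f (?V n \<omega>)"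
        "?E n \<omega> \<le> fhi n \<omega> (?V n \<omega>) \<longleftrightarrow> ?E n \<omega> \<le> g (?V n \<omega>)"
        using * by auto
      then show "\<omega> \<in> C n \<longleftrightarrow> \<omega> \<in> S n"
        using \<omega>(1) by (auto simp: C_def S_def qfcv_interval_def)
    qed
    have "measure M (C n) \<le> measure M (S n \<union> B n)"
    proof (rule M.finite_measure_mono_AE)
      show "AE \<omega> in M. \<omega> \<in> C n \<longrightarrow> \<omega> \<in> S n \<union> B n" using agree by eventually_elim blast
    qed (intro sets.Un S_set B_set)
    moreover have "measure M (S n) \<le> measure M (C n \<union> B n)"
    proof (rule M.finite_measure_mono_AE)
      show "AE \<omega> in M. \<omega> \<in> S n \<longrightarrow> \<omega> \<in> C n \<union> B n" using agree by eventually_elim blast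
    qed (intro sets.Un C_set B_set)
    moreover have "measure M (S n \<union> B n) \<le> measure M (S n) + measure M (B n)"
      "measure M (C n \<union> B n) \<le> measure M (C n) + measure M (B n)"
      by (intro measure_Un_le S_set C_set B_set)+
    ultimately show ?thesis using prob_S by linarith
  qed
  have bound: "measure M (B n) \<le> measure M {\<omega> \<in> space M. flo n \<omega> \<notin> ?lo} + measure M {\<omega> \<in> space M. fhi n \<omega> \<notin> ?hi}"
    if n: "n \<ge> ?N" for n
  proof -
    have "flo n \<in> M \<rightarrow>\<^sub>M count_space F" "fhi n \<in> M \<rightarrow>\<^sub>M count_space F"
      using assms(21,22)[OF n] unfolding qfcv_fit_def by auto
    from this[THEN measurable_sets_Collect, of "\<lambda>h. h \<notin> ?lo"] this[THEN measurable_sets_Collect, of "\<lambda>h. h \<notin> ?hi"]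
    show ?thesis unfolding B_def by (intro measure_Un_le) auto
  qed
  have "(\<lambda>n. measure M (C n) - (1 - \<alpha>)) \<longlonglongrightarrow> 0"
  proof (rule Lim_null_comparison)
    show "eventually (\<lambda>n. norm (measure M (C n) - (1 - \<alpha>)) \<le>
      measure M {\<omega> \<in> space M. flo n \<omega> \<notin> ?lo} + measure M {\<omega> \<in> space M. fhi n \<omega> \<notin> ?hi}) sequentially"
      using eventually_ge_at_top[of ?N]
      by eventually_elim (simp only: real_norm_def order_trans[OF close bound])
    show "(\<lambda>n. measure M {\<omega> \<in> space M. flo n \<omega> \<notin> ?lo} + measure M {\<omega> \<in> space M. fhi n \<omega> \<notin> ?hi}) \<longlonglongrightarrow> 0"
      using tendsto_add[OF lo_lim hi_lim] by simp
  qed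
  then show ?thesis
    unfolding C_def by (rule LIM_zero_cancel)
qed

end
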